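(* Let $n\ge1$ and $m\ge2$ be integers and let $\Delta=\Delta^m(\mathbb{R}^{n+1})$ be the system of half-open parabolic $m$-adic cubes. Let $\mu$ be a Radon measure on $\mathbb{R}^{n+1}$ and let $E\subset\mathbb{R}^{n+1}$ be a Borel set with $\mu(\mathbb{R}^{n+1}\setminus E)=0$. Suppose there exist constants $0<\rho<n+2$ and $\lambda>0$ such that for every $Q\in\Delta$ with $\operatorname{side}Q\le1$, at least one of the following holds: $$\mathcal{M}^{n+2-\rho}_{m^{-1}\operatorname{side}Q}(E\cap Q)<(\operatorname{side}Q)^{n+2-\rho}$$ or $$\sum_{R\in\mathsf{Child}(Q)}\mu(R)^{1/2}(\operatorname{vol}R)^{1/2}\le m^{-\lambda}\,\mu(Q)^{1/2}(\operatorname{vol}Q)^{1/2}.$$ Then the upper parabolic Hausdorff dimension of $\mu$ is at most $n+2-\lambda\rho/(\lambda+\rho)$.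
   Context: $\mathbb{R}^{n+1}=\mathbb{R}^n\times\mathbb{R}$ is equipped with the parabolic distance $\operatorname{dist}((X,t),(Y,s))=\max\{|X-Y|,|t-s|^{1/2}\}$, $|\cdot|$ the Euclidean norm on $\mathbb{R}^n$; Hausdorff dimension $\dim_H$ is computed with respect to this distance. The upper (parabolic) Hausdorff dimension of a Borel measure $\mu$ is $\inf\{\dim_HF: F\text{ Borel},\ \mu(\mathbb{R}^{n+1}\setminus F)=0\}$. $\Delta^m(\mathbb{R}^{n+1})$ is the collection of all sets $$Q=\Big[\tfrac{j_1}{m^k},\tfrac{j_1+1}{m^k}\Big)\times\cdots\times\Big[\tfrac{j_n}{m^k},\tfrac{j_n+1}{m^k}\Big)\times\Big[\tfrac{j_{n+1}}{m^{2k}},\tfrac{j_{n+1}+1}{m^{2k}}\Big),\qquad k,j_1,\dots,j_{n+1}\in\mathbb{Z};$$ such a $Q$ has generation $k$, side length $\operatorname{side}Q=m^{-k}$, and volume $\operatorname{vol}Q=m^{-k(n+2)}$. $\mathsf{Child}(Q)$ is the set of the $m^{n+2}$ cubes $R\in\Delta^m(\mathbb{R}^{n+1})$ of generation $k+1$ contained in $Q$. For $\sigma\ge0$ and $\delta\in(0,\infty]$, $\mathcal{M}^\sigma_\delta(A)=\inf\{\sum_i(\operatorname{side}E_i)^\sigma: A\subseteq\bigcup_{i}E_i\ (\text{countable union}),\ \operatorname{side}E_i\le\delta,\ E_i\in\Delta\}$. *)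

theory Defs
  imports "HOL-Analysis.Analysis"
begin

definition radon_measure :: "'a::topological_space measure \<Rightarrow> bool" where
  "radon_measure M \<longleftrightarrow>
     sets M = sets borel \<and>
     (\<forall>K. compact K \<longrightarrow> emeasure M K < \<infinity>) \<and>
     (\<forall>A\<in>sets borel. emeasure M A = (INF U\<in>{U. open U \<and> A \<subseteq> U}. emeasure M U)) \<and>
     (\<forall>U. open U \<longrightarrow> emeasure M U = (SUP K\<in>{K. compact K \<and> K \<subseteq> U}. emeasure M K))"

section \<open>Hausdorff dimension with respect to a distance function\<close>

text \<open>The distance is a parameter because the parabolic distance is not the one that
  the type \<open>real^'n \<times> real\<close> carries. The gauge uses the convention \<open>0\<^sup>0 = 1\<close> on
  nonempty sets, whereas \<open>0 powr 0 = 0\<close>. It is applied to bounded sets only.\<close>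

definition diam_pow :: "('a \<Rightarrow> 'a \<Rightarrow> real) \<Rightarrow> real \<Rightarrow> 'a set \<Rightarrow> real" where
  "diam_pow d s U =
     (if U = {} then 0
      else if s = 0 then 1
      else (SUP (x, y)\<in>U \<times> U. d x y) powr s)"

definition hausdorff_content ::
    "('a \<Rightarrow> 'a \<Rightarrow> real) \<Rightarrow> real \<Rightarrow> real \<Rightarrow> 'a set \<Rightarrow> ennreal" where
  "hausdorff_content d s \<delta> A =
     (INF U\<in>{U :: nat \<Rightarrow> 'a set.
          A \<subseteq> (\<Union>i. U i) \<and> (\<forall>i. \<forall>x\<in>U i. \<forall>y\<in>U i. d x y \<le> \<delta>)}.
        (\<Sum>i. ennreal (diam_pow d s (U i))))"

definition hausdorff_measure :: "('a \<Rightarrow> 'a \<Rightarrow> real) \<Rightarrow> real \<Rightarrow> 'a set \<Rightarrow> ennreal" where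
  "hausdorff_measure d s A = (SUP \<delta>\<in>{0<..}. hausdorff_content d s \<delta> A)"

definition hausdorff_dim :: "('a \<Rightarrow> 'a \<Rightarrow> real) \<Rightarrow> 'a set \<Rightarrow> ereal" where
  "hausdorff_dim d A = (INF s\<in>{s. 0 \<le> s \<and> hausdorff_measure d s A = 0}. ereal s)"

section \<open>Parabolic space\<close>

definition parabolic_dist :: "(real^'n) \<times> real \<Rightarrow> (real^'n) \<times> real \<Rightarrow> real" where
  "parabolic_dist p q = max (norm (fst p - fst q)) (\<bar>snd p - snd q\<bar> powr (1/2))"

text \<open>The parabolic distance induces the product topology, so the Borel sets are those
  of the library instance.\<close>

definition upper_parabolic_dim :: "((real^'n) \<times> real) measure \<Rightarrow> ereal" where
  "upper_parabolic_dim M =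
     (INF F\<in>{F \<in> sets borel. emeasure M (UNIV - F) = 0}. hausdorff_dim parabolic_dist F)"

section \<open>Parabolic \<open>m\<close>-adic cubes\<close>

definition pcube :: "nat \<Rightarrow> int \<Rightarrow> ('n \<Rightarrow> int) \<Rightarrow> int \<Rightarrow> ((real^'n) \<times> real) set" where
  "pcube m k j l =
     {(X, t). (\<forall>i. X $ i \<in> {of_int (j i) / real m powi k ..< (of_int (j i) + 1) / real m powi k}) \<and>
              t \<in> {of_int l / real m powi (2 * k) ..< (of_int l + 1) / real m powi (2 * k)}}"

definition pcubes :: "nat \<Rightarrow> ((real^'n) \<times> real) set set" where
  "pcubes m = {Q. \<exists>k j l. Q = pcube m k j l}"

text \<open>The generation is determined by the cube as a set when \<open>m \<ge> 2\<close>; see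
  \<open>generation_pcube\<close> below.\<close>

definition generation :: "nat \<Rightarrow> ((real^'n) \<times> real) set \<Rightarrow> int" where
  "generation m Q = (THE k. \<exists>j l. Q = pcube m k j l)"

definition side :: "nat \<Rightarrow> ((real^'n) \<times> real) set \<Rightarrow> real" where
  "side m Q = real m powi (- generation m Q)"

definition vol :: "nat \<Rightarrow> ((real^'n) \<times> real) set \<Rightarrow> real" where
  "vol m Q = real m powi (- generation m Q * (int CARD('n) + 2))"

definition Child :: "nat \<Rightarrow> ((real^'n) \<times> real) set \<Rightarrow> ((real^'n) \<times> real) set set" where
  "Child m Q = {R \<in> pcubes m. generation m R = generation m Q + 1 \<and> R \<subseteq> Q}"

text \<open>Countable covers are indexed by an arbitrary set of natural numbers, so that finite
  covers and the empty cover are included.\<close>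

definition net_content ::
    "nat \<Rightarrow> real \<Rightarrow> ennreal \<Rightarrow> ((real^'n) \<times> real) set \<Rightarrow> ennreal" where
  "net_content m \<sigma> \<delta> A =
     (INF (I, E)\<in>{(I :: nat set, E :: nat \<Rightarrow> ((real^'n) \<times> real) set).
          A \<subseteq> (\<Union>i\<in>I. E i) \<and> (\<forall>i\<in>I. E i \<in> pcubes m \<and> ennreal (side m (E i)) \<le> \<delta>)}.
        (\<Sum>i. if i \<in> I then ennreal (side m (E i) powr \<sigma>) else 0))"

section \<open>Generations are well defined, and cubes have the right number of children\<close>

lemma pcube_corner:
  assumes "m \<ge> 2"
  shows "((\<chi> i. of_int (j i) / real m powi k), of_int l / real m powi (2 * k)) \<in> pcube m k j l"
  using assms by (auto simp: pcube_def divide_strict_right_mono)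

lemma snd_pcube:
  assumes "m \<ge> 2"
  shows "snd ` pcube m k (j :: 'n::finite \<Rightarrow> int) l =
    {of_int l / real m powi (2 * k) ..< (of_int l + 1) / real m powi (2 * k)}"
proof (intro equalityI subsetI)
  fix t assume "t \<in> {of_int l / real m powi (2 * k) ..< (of_int l + 1) / real m powi (2 * k)}"
  then have "((\<chi> i. of_int (j i) / real m powi k), t) \<in> pcube m k j l"
    using assms by (auto simp: pcube_def divide_strict_right_mono)
  then show "t \<in> snd ` pcube m k j l" by force
qed (auto simp: pcube_def split: if_splits)

lemma pcube_eq_generation:
  assumes m: "m \<ge> 2" and eq: "pcube m k (j :: 'n::finite \<Rightarrow> int) l = pcube m k' j' l'"
  shows "k = k'"
proof -
  have pos: "real m powi (2 * a) > 0" for a using m by simp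
  have "{of_int l / real m powi (2 * k) ..< (of_int l + 1) / real m powi (2 * k)} =
        {of_int l' / real m powi (2 * k') ..< (of_int l' + 1) / real m powi (2 * k')}"
    using snd_pcube[OF m, of k j l] snd_pcube[OF m, of k' j' l'] eq by simp
  moreover have "of_int l / real m powi (2 * k) < (of_int l + 1) / real m powi (2 * k)"
    using pos by (simp add: divide_strict_right_mono)
  ultimately have "of_int l / real m powi (2 * k) = of_int l' / real m powi (2 * k')"
     "(of_int l + 1) / real m powi (2 * k) = (of_int l' + 1) / real m powi (2 * k')"
    by (simp_all add: Ico_eq_Ico)
  then have "1 / real m powi (2 * k) = 1 / real m powi (2 * k')"
    by (simp add: add_divide_distrib)
  then have e: "real m powi (2 * k) = real m powi (2 * k')" by simp
  have "real m powi (2 * a) < real m powi (2 * b)" if "a < b" for a b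
    using m that by (intro power_int_strict_increasing) auto
  from this[of k k'] this[of k' k] e show ?thesis by (metis less_irrefl linorder_cases)
qed

lemma generation_pcube:
  assumes "m \<ge> 2"
  shows "generation m (pcube m k (j :: 'n::finite \<Rightarrow> int) l) = k"
  unfolding generation_def using pcube_eq_generation[OF assms] by (intro the_equality) blast+

lemma pcube_inj:
  assumes m: "m \<ge> 2" and eq: "pcube m k (j :: 'n::finite \<Rightarrow> int) l = pcube m k j' l'"
  shows "j = j'" "l = l'"
proof -
  have pos: "real m powi a > 0" for a using m by simp
  have aux: "a = b" if "of_int a / c \<le> of_int b / c" "of_int b / c < (of_int a + 1) / c" "c > 0"
    for a b :: int and c :: real
    using that by (auto simp: divide_le_cancel divide_less_cancel)
  have "((\<chi> i. of_int (j' i) / real m powi k), of_int l' / real m powi (2 * k)) \<in> pcube m k j l"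
    using pcube_corner[OF m, of j' k l'] eq by simp
  then have c: "\<forall>i. of_int (j' i) / real m powi k \<in>
      {of_int (j i) / real m powi k ..< (of_int (j i) + 1) / real m powi k}"
     "of_int l' / real m powi (2 * k) \<in>
      {of_int l / real m powi (2 * k) ..< (of_int l + 1) / real m powi (2 * k)}"
    by (auto simp: pcube_def)
  show "j = j'"
  proof
    fix i show "j i = j' i" using c(1) pos by (intro aux[of _ "real m powi k"]) auto
  qed
  show "l = l'" using c(2) pos by (intro aux[of _ "real m powi (2 * k)"]) auto
qed

lemma Ico_refine:
  fixes a b p :: int and c :: real
  assumes c: "c > 0" and p: "p > 0"
  shows "of_int a / c \<le> of_int b / (c * of_int p) \<longleftrightarrow> a * p \<le> b"
    and "of_int b / (c * of_int p) < (of_int a + 1) / c \<longleftrightarrow> b < a * p + p"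
    and "(of_int b + 1) / (c * of_int p) \<le> (of_int a + 1) / c \<longleftrightarrow> b < a * p + p"
proof -
  have 1: "of_int x / c = of_int (x * p) / (c * of_int p)" for x :: int using c p by simp
  have cp: "c * of_int p > 0" using c p by simp
  have 2: "of_int x / (c * of_int p) \<le> of_int y / (c * of_int p) \<longleftrightarrow> x \<le> y"
          "of_int x / (c * of_int p) < of_int y / (c * of_int p) \<longleftrightarrow> x < y" for x y :: int
    using cp by (simp_all only: divide_le_cancel divide_less_cancel) auto
  show "of_int a / c \<le> of_int b / (c * of_int p) \<longleftrightarrow> a * p \<le> b"
    by (subst 1) (simp only: 2)
  show "of_int b / (c * of_int p) < (of_int a + 1) / c \<longleftrightarrow> b < a * p + p"
    using 1[of "a + 1"] 2(2)[of b "(a + 1) * p"] by (simp add: algebra_simps)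
  show "(of_int b + 1) / (c * of_int p) \<le> (of_int a + 1) / c \<longleftrightarrow> b < a * p + p"
    using 1[of "a + 1"] 2(1)[of "b + 1" "(a + 1) * p"]
    by (metis add1_zle_eq distrib_right mult_1 of_int_1 of_int_add)
qed

lemma pcube_subset_iff:
  assumes m: "m \<ge> 2"
  shows "pcube m (k + 1) j' l' \<subseteq> pcube m k (j :: 'n::finite \<Rightarrow> int) l \<longleftrightarrow>
    (\<forall>i. j' i \<in> {j i * int m ..< j i * int m + int m}) \<and>
    l' \<in> {l * (int m)\<^sup>2 ..< l * (int m)\<^sup>2 + (int m)\<^sup>2}"
    (is "?L \<longleftrightarrow> ?R")
proof -
  have s1: "real m powi (k + 1) = real m powi k * of_int (int m)"
    using m by (simp add: power_int_add)
  have s2: "real m powi (2 * (k + 1)) = real m powi (2 * k) * of_int ((int m)\<^sup>2)"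
    using m by (simp add: power_int_add distrib_left)
  have pos: "real m powi a > 0" "int m > 0" "(int m)\<^sup>2 > 0" for a using m by auto
  note I1 = Ico_refine[OF pos(1,2)] and I2 = Ico_refine[OF pos(1,3)]
  show ?thesis
  proof
    assume ?L
    then have "((\<chi> i. of_int (j' i) / real m powi (k + 1)),
        of_int l' / real m powi (2 * (k + 1))) \<in> pcube m k j l"
      using pcube_corner[OF m] by blast
    then show ?R
      unfolding pcube_def s1 s2 by (simp only: I1 I2 mem_Collect_eq prod.case atLeastLessThan_iff vec_lambda_beta simp_thms)
  next
    assume R: ?R
    have 1: "of_int (j i) / real m powi k \<le> of_int (j' i) / real m powi (k + 1)"
      "(of_int (j' i) + 1) / real m powi (k + 1) \<le> (of_int (j i) + 1) / real m powi k" for i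
      using R unfolding s1 I1 by auto
    have 2: "of_int l / real m powi (2 * k) \<le> of_int l' / real m powi (2 * (k + 1))"
      "(of_int l' + 1) / real m powi (2 * (k + 1)) \<le> (of_int l + 1) / real m powi (2 * k)"
      using R unfolding s2 I2 by auto
    show ?L
      unfolding pcube_def using 1 2 by (fastforce intro: order.trans less_le_trans)
  qed
qed

lemma card_Child:
  assumes m: "m \<ge> 2" and Q: "(Q :: ((real^'n) \<times> real) set) \<in> pcubes m"
  shows "card (Child m Q) = m ^ (CARD('n) + 2)" "finite (Child m Q)"
proof -
  obtain k j l where Q: "Q = pcube m k j l" using Q by (auto simp: pcubes_def)
  define S where "S = (PiE (UNIV :: 'n set) (\<lambda>i. {j i * int m ..< j i * int m + int m})) \<times>
    {l * (int m)\<^sup>2 ..< l * (int m)\<^sup>2 + (int m)\<^sup>2}"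
  have S: "(j', l') \<in> S \<longleftrightarrow> pcube m (k + 1) j' l' \<subseteq> pcube m k j l" for j' l'
    unfolding S_def pcube_subset_iff[OF m] by (auto simp: PiE_iff)
  have "R \<in> Child m Q \<longleftrightarrow> (\<exists>j' l'. R = pcube m (k + 1) j' l' \<and> R \<subseteq> pcube m k j l)" for R
    unfolding Child_def Q pcubes_def by (auto simp: generation_pcube[OF m]) blast
  then have "Child m Q = (\<lambda>(j', l'). pcube m (k + 1) j' l') ` S"
    using S by (fastforce simp: image_iff)
  moreover have "inj_on (\<lambda>(j', l'). pcube m (k + 1) j' l') S"
    using pcube_inj[OF m] by (auto simp: inj_on_def)
  moreover have "card S = m ^ (CARD('n) + 2)"
    by (simp add: S_def card_cartesian_product card_PiE power_add power2_eq_square nat_mult_distrib)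
  moreover have "finite S" by (auto simp: S_def intro!: finite_PiE)
  ultimately show "card (Child m Q) = m ^ (CARD('n) + 2)" "finite (Child m Q)"
    by (auto simp: card_image)
qed

end

theory Submission
  imports Defs
begin

text \<open>Write \<open>N = n + 2\<close> and \<open>\<beta> = min \<lambda> (\<rho>/2)\<close>. The argument gives the dimension bound
  \<open>N - 2\<beta>\<close>, and \<open>\<lambda>\<rho>/(\<lambda> + \<rho>)\<close> is at most both \<open>\<lambda>\<close> and \<open>\<rho>\<close>, hence at most \<open>2\<beta>\<close>.

  Give a cube \<open>Q\<close> the weight \<open>\<mu>(Q)\<^sup>1\<^sup>/\<^sup>2 (side Q)\<^sup>\<tau>\<close> with \<open>\<tau> = N/2 - \<beta>\<close>. Each of the two
  alternatives covers \<open>E \<inter> Q\<close> by strictly smaller cubes of total weight at most the weight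
  of \<open>Q\<close>. If the content of \<open>E \<inter> Q\<close> is small, take the maximal cubes of an
  efficient cover; they are disjoint, and the Cauchy--Schwarz inequality separates the sum of
  the measures from the sum of the powers \<open>(side R)\<^sup>N\<^sup>-\<^sup>\<rho>\<close> (\<open>refine_by_small_content\<close>). In the other
  case take the children, for which the hypothesis is already a statement about the weight with
  \<open>\<beta> = 0\<close> that has a factor \<open>m\<^sup>-\<^sup>\<lambda>\<close> to spare (\<open>refine_by_children\<close>). Iteration covers
  \<open>E \<inter> Q\<close> by arbitrarily small cubes without an increase of the total weight
  (\<open>refine_repeatedly\<close>).

  Now let \<open>s > 2\<tau> = N - 2\<beta>\<close>, and call a cube heavy if \<open>\<mu>(R) > (side R)\<^sup>s\<close>. A light
  cube satisfies \<open>\<mu>(R) \<le> \<mu>(R)\<^sup>1\<^sup>/\<^sup>2 (side R)\<^sup>s\<^sup>/\<^sup>2\<close>, which is its weight times a positive power of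
  its side. So light cubes of the iterated covers carry a total measure that tends to 0, and
  almost every point lies in heavy cubes of arbitrarily small side
  (\<open>null_if_cubes_light\<close>, \<open>heavy_points_full_measure\<close>). Conversely, disjoint heavy
  cubes in a cube of finite measure have a bounded sum of \<open>(side R)\<^sup>s\<close>, so the set of
  these points has Hausdorff measure 0 in every dimension \<open>s' > s\<close>
  (\<open>hausdorff_measure_heavy_points\<close>).\<close>

section \<open>Sums over countable families\<close>

text \<open>Sums over families of cubes are written as integrals with respect to counting
  measure: they take values in \<open>[0, \<infinity>]\<close>, need no enumeration of the family, and can be
  interchanged with each other and with integrals against \<open>M\<close>.\<close>

lemma nn_integral_count_space_mono_set:
  assumes "A \<subseteq> B"
  shows "(\<integral>\<^sup>+x. f x \<partial>count_space A) \<le> (\<integral>\<^sup>+x. f x \<partial>count_space B)"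
proof -
  have "(\<integral>\<^sup>+x. f x * indicator A x \<partial>count_space UNIV)
      \<le> (\<integral>\<^sup>+x. f x * indicator B x \<partial>count_space UNIV)"
    using assms by (intro nn_integral_mono) (auto split: split_indicator)
  also have "(\<integral>\<^sup>+x. f x * indicator A x \<partial>count_space UNIV) = (\<integral>\<^sup>+x. f x \<partial>count_space A)"
    by (cases "A = UNIV") (auto simp: nn_integral_count_space_indicator)
  also have "(\<integral>\<^sup>+x. f x * indicator B x \<partial>count_space UNIV) = (\<integral>\<^sup>+x. f x \<partial>count_space B)"
    by (cases "B = UNIV") (auto simp: nn_integral_count_space_indicator)
  finally show ?thesis .
qed

lemma nn_integral_count_space_UN_le:
  fixes f :: "'a \<Rightarrow> ennreal"
  assumes I: "countable I"
  shows "(\<integral>\<^sup>+x. f x \<partial>count_space (\<Union>i\<in>I. A i))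
      \<le> (\<integral>\<^sup>+i. (\<integral>\<^sup>+x. f x \<partial>count_space (A i)) \<partial>count_space I)"
proof -
  have ind: "(\<integral>\<^sup>+x. f x \<partial>count_space B) = (\<integral>\<^sup>+x. f x * indicator B x \<partial>count_space UNIV)" for B
    by (cases "B = UNIV") (auto simp: nn_integral_count_space_indicator)
  have "(\<integral>\<^sup>+x. f x * indicator (\<Union>i\<in>I. A i) x \<partial>count_space UNIV)
      \<le> (\<integral>\<^sup>+x. (\<integral>\<^sup>+i. f x * indicator (A i) x \<partial>count_space I) \<partial>count_space UNIV)"
  proof (rule nn_integral_mono)
    fix x
    show "f x * indicator (\<Union>i\<in>I. A i) x \<le> (\<integral>\<^sup>+i. f x * indicator (A i) x \<partial>count_space I)"
    proof (cases "x \<in> (\<Union>i\<in>I. A i)")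
      case True
      then obtain j where "j \<in> I" "x \<in> A j" by blast
      with nn_integral_ge_point[of j I "\<lambda>i. f x * indicator (A i) x"] True
      show ?thesis by simp
    qed simp
  qed
  also have "\<dots> = (\<integral>\<^sup>+i. (\<integral>\<^sup>+x. f x * indicator (A i) x \<partial>count_space UNIV) \<partial>count_space I)"
    by (rule nn_integral_count_space_nn_integral[OF I]) simp
  finally show ?thesis by (simp only: ind)
qed

lemma emeasure_Union_le_nn_integral:
  assumes T: "countable T" and sets: "T \<subseteq> sets M"
  shows "emeasure M (\<Union>T) \<le> (\<integral>\<^sup>+Q. emeasure M Q \<partial>count_space T)"
proof -
  have U: "\<Union>T \<in> sets M" using T sets by (rule sets.countable_Union)
  have "emeasure M (\<Union>T) = (\<integral>\<^sup>+x. indicator (\<Union>T) x \<partial>M)"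
    using U by simp
  also have "\<dots> \<le> (\<integral>\<^sup>+x. (\<integral>\<^sup>+Q. indicator Q x \<partial>count_space T) \<partial>M)"
  proof (rule nn_integral_mono)
    fix x
    show "indicator (\<Union>T) x \<le> (\<integral>\<^sup>+Q. (indicator Q x :: ennreal) \<partial>count_space T)"
    proof (cases "x \<in> \<Union>T")
      case True
      then obtain R where "R \<in> T" "x \<in> R" by blast
      with nn_integral_ge_point[of R T "\<lambda>Q. indicator Q x :: ennreal"] True
      show ?thesis by simp
    qed simp
  qed
  also have "\<dots> = (\<integral>\<^sup>+Q. (\<integral>\<^sup>+x. indicator Q x \<partial>M) \<partial>count_space T)"
    using sets by (intro nn_integral_count_space_nn_integral[OF T]) auto
  also have "\<dots> = (\<integral>\<^sup>+Q. emeasure M Q \<partial>count_space T)"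
    using sets by (intro nn_integral_cong) auto
  finally show ?thesis .
qed

lemma emeasure_disjoint_Union:
  assumes "countable T" "T \<subseteq> sets M" "disjoint T"
  shows "(\<integral>\<^sup>+Q. emeasure M Q \<partial>count_space T) = emeasure M (\<Union>T)"
  using emeasure_UN_countable[of T "\<lambda>Q. Q" M] assms
  by (auto simp: disjoint_family_on_def disjoint_def subset_iff)

lemma nn_integral_image_le:
  fixes f :: "'a \<Rightarrow> ennreal" and I :: "nat set"
  shows "(\<integral>\<^sup>+x. f x \<partial>count_space (e ` I)) \<le> (\<Sum>i. if i \<in> I then f (e i) else 0)"
proof -
  have "(\<integral>\<^sup>+x. f x \<partial>count_space (\<Union>i\<in>I. {e i}))
      \<le> (\<integral>\<^sup>+i. (\<integral>\<^sup>+x. f x \<partial>count_space {e i}) \<partial>count_space I)"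
    by (rule nn_integral_count_space_UN_le) simp
  also have "\<dots> = (\<integral>\<^sup>+i. f (e i) \<partial>count_space I)"
    by (simp add: nn_integral_count_space_finite)
  also have "\<dots> = (\<integral>\<^sup>+i. (if i \<in> I then f (e i) else 0) \<partial>count_space I)"
    by (intro nn_integral_cong) simp
  also have "\<dots> \<le> (\<integral>\<^sup>+i. (if i \<in> I then f (e i) else 0) \<partial>count_space UNIV)"
    by (rule nn_integral_count_space_mono_set) simp
  finally show ?thesis by (simp add: nn_integral_count_space_nat UNION_singleton_eq_range)
qed

text \<open>Hausdorff contents are defined by covers indexed by all natural numbers; a family
  that is finite is padded with empty sets.\<close>

lemma countable_family_as_sequence:
  fixes f :: "'a set \<Rightarrow> ennreal"
  assumes T: "countable T" and f0: "f {} = 0"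
  obtains U where "\<Union>T = (\<Union>i::nat. U i)" "\<And>i. U i = {} \<or> U i \<in> T"
    "(\<Sum>i. f (U i)) \<le> (\<integral>\<^sup>+Q. f Q \<partial>count_space T)"
proof
  define J where "J = to_nat_on T ` T"
  define U where "U i = (if i \<in> J then from_nat_into T i else {})" for i
  have inv: "from_nat_into T (to_nat_on T Q) = Q" if "Q \<in> T" for Q
    using T that by simp
  show "\<Union>T = (\<Union>i. U i)"
    by (fastforce simp: U_def J_def inv split: if_splits)
  show "U i = {} \<or> U i \<in> T" for i
    by (auto simp: U_def J_def inv)
  have bij: "bij_betw (to_nat_on T) T J"
    unfolding J_def using T by (simp add: inj_on_imp_bij_betw inj_on_to_nat_on)
  have "(\<Sum>i. f (U i)) = (\<integral>\<^sup>+i. f (U i) \<partial>count_space UNIV)"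
    by (simp add: nn_integral_count_space_nat)
  also have "\<dots> = (\<integral>\<^sup>+i. f (U i) \<partial>count_space J)"
    by (rule nn_integral_count_space_eq) (auto simp: U_def f0)
  also have "\<dots> = (\<integral>\<^sup>+Q. f (U (to_nat_on T Q)) \<partial>count_space T)"
    by (rule nn_integral_bij_count_space[OF bij, symmetric])
  also have "\<dots> = (\<integral>\<^sup>+Q. f Q \<partial>count_space T)"
    by (rule nn_integral_cong) (auto simp: U_def J_def inv)
  finally show "(\<Sum>i. f (U i)) \<le> (\<integral>\<^sup>+Q. f Q \<partial>count_space T)" by simp
qed

lemma ennreal_le_if_power2_le:
  assumes "x\<^sup>2 \<le> ennreal (a\<^sup>2)" "0 \<le> a"
  shows "x \<le> ennreal a"
proof (cases x)
  case (real r)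
  with assms have "r\<^sup>2 \<le> a\<^sup>2" by (simp add: ennreal_power)
  then have "r \<le> a" using assms(2) by (rule power2_le_imp_le)
  then show ?thesis using real by (simp add: ennreal_leI)
next
  case top
  with assms(1) show ?thesis by (simp add: power2_eq_square ennreal_mult_top top_unique)
qed

section \<open>Geometry of the parabolic cubes\<close>

lemma pcubeE:
  assumes "m \<ge> 2" "Q \<in> pcubes m"
  obtains k j l where "Q = pcube m k j l" "generation m Q = k"
  using assms by (auto simp: pcubes_def generation_pcube)

lemma pcube_in_pcubes: "pcube m k j l \<in> pcubes m"
  by (auto simp: pcubes_def)

lemma side_pos: "m \<ge> 2 \<Longrightarrow> 0 < side m Q"
  by (simp add: side_def)

lemma side_le_iff:
  assumes "m \<ge> 2"
  shows "side m R \<le> side m Q \<longleftrightarrow> generation m Q \<le> generation m R"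
proof -
  have "real m powi a < real m powi b" if "a < b" for a b :: int
    using assms that by (intro power_int_strict_increasing) auto
  then show ?thesis unfolding side_def
    by (metis linorder_not_le neg_le_iff_le order_less_le)
qed

lemma side_le_div_iff:
  assumes "m \<ge> 2"
  shows "side m R \<le> side m Q / real m \<longleftrightarrow> generation m Q + 1 \<le> generation m R"
proof -
  have *: "side m Q / real m = real m powi (- generation m Q - 1)"
    using assms by (simp add: side_def power_int_diff)
  have "real m powi a < real m powi b" if "a < b" for a b :: int
    using assms that by (intro power_int_strict_increasing) auto
  then have "real m powi a \<le> real m powi b \<longleftrightarrow> a \<le> b" for a b :: int
    by (metis linorder_not_le order_less_le)
  then show ?thesis unfolding * unfolding side_def by auto
qed

lemma side_le_power:
  assumes "m \<ge> 2" "int k \<le> generation m Q"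
  shows "side m Q \<le> (1 / real m) ^ k"
proof -
  have "side m Q \<le> real m powi (- int k)"
    unfolding side_def using assms by (intro power_int_increasing) auto
  then show ?thesis by (simp add: power_int_minus field_simps)
qed

lemma vol_eq_side_powr:
  fixes Q :: "((real^'n) \<times> real) set"
  assumes "m \<ge> 2"
  shows "vol m Q = side m Q powr (real CARD('n) + 2)"
proof -
  have "vol m Q = side m Q powi int (CARD('n) + 2)"
    by (simp only: side_def vol_def power_int_mult of_nat_add of_nat_numeral)
  also have "\<dots> = side m Q powr real (CARD('n) + 2)"
    by (simp only: power_int_of_nat powr_realpow[OF side_pos[OF assms]])
  finally show ?thesis by (simp only: of_nat_add of_nat_numeral)
qed

lemma Ico_grid_nested:
  fixes a b p :: int and c t :: real
  assumes "c > 0" "p > 0"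
    and "of_int a / c \<le> t" "t < (of_int a + 1) / c"
    and "of_int b / (c * of_int p) \<le> t" "t < (of_int b + 1) / (c * of_int p)"
  shows "of_int a / c \<le> of_int b / (c * of_int p)"
    and "(of_int b + 1) / (c * of_int p) \<le> (of_int a + 1) / c"
proof -
  have "of_int b / (c * of_int p) < (of_int a + 1) / c" using assms by linarith
  then show "(of_int b + 1) / (c * of_int p) \<le> (of_int a + 1) / c"
    using Ico_refine(2,3)[OF assms(1,2)] by blast
  have "\<not> (of_int b + 1) / (c * of_int p) \<le> (of_int (a - 1) + 1) / c" using assms by simp
  then have "a * p \<le> b"
    using Ico_refine(3)[OF assms(1,2), of b "a - 1"] by (simp add: algebra_simps)
  then show "of_int a / c \<le> of_int b / (c * of_int p)"
    using Ico_refine(1)[OF assms(1,2)] by blast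
qed

lemma pcubes_nested:
  fixes Q R :: "((real^'n) \<times> real) set"
  assumes m: "m \<ge> 2" and Q: "Q \<in> pcubes m" and R: "R \<in> pcubes m"
    and gen: "generation m Q \<le> generation m R" and meet: "Q \<inter> R \<noteq> {}"
  shows "R \<subseteq> Q"
proof -
  obtain k j l where Qe: "Q = pcube m k j l" and k: "generation m Q = k"
    using pcubeE[OF m Q] .
  obtain k' j' l' where Re: "R = pcube m k' j' l'" and k': "generation m R = k'"
    using pcubeE[OF m R] .
  define d where "d = nat (k' - k)"
  have k': "k' = k + int d" using gen by (simp add: k k' d_def)
  have s1: "real m powi (k + int d) = real m powi k * of_int (int m ^ d)"
    using m by (simp add: power_int_add)
  have s2: "real m powi (2 * (k + int d)) = real m powi (2 * k) * of_int (int m ^ (2 * d))"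
    using m by (simp add: power_int_add distrib_left flip: power_int_of_nat)
  have pos: "real m powi a > 0" "int m ^ e > 0" for a e using m by auto
  obtain X t where p: "(X, t) \<in> Q" "(X, t) \<in> R" using meet by auto
  have X: "of_int (j i) / real m powi k \<le> X $ i" "X $ i < (of_int (j i) + 1) / real m powi k"
    "of_int (j' i) / real m powi (k + int d) \<le> X $ i"
    "X $ i < (of_int (j' i) + 1) / real m powi (k + int d)" for i
    using p unfolding Qe Re pcube_def k' by auto
  have t: "of_int l / real m powi (2 * k) \<le> t" "t < (of_int l + 1) / real m powi (2 * k)"
    "of_int l' / real m powi (2 * (k + int d)) \<le> t"
    "t < (of_int l' + 1) / real m powi (2 * (k + int d))"
    using p unfolding Qe Re pcube_def k' by auto
  have I: "of_int (j i) / real m powi k \<le> of_int (j' i) / real m powi (k + int d)"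
    "(of_int (j' i) + 1) / real m powi (k + int d) \<le> (of_int (j i) + 1) / real m powi k" for i
    using Ico_grid_nested[OF pos X[unfolded s1]] unfolding s1 by auto
  have II: "of_int l / real m powi (2 * k) \<le> of_int l' / real m powi (2 * (k + int d))"
    "(of_int l' + 1) / real m powi (2 * (k + int d)) \<le> (of_int l + 1) / real m powi (2 * k)"
    using Ico_grid_nested[OF pos t[unfolded s2]] unfolding s2 by auto
  show ?thesis
    unfolding Qe Re k' pcube_def using I II
    by (fastforce intro: order.trans less_le_trans)
qed

lemma pcube_containing:
  fixes x :: "(real^'n) \<times> real"
  assumes m: "m \<ge> 2"
  obtains Q where "Q \<in> pcubes m" "generation m Q = k" "x \<in> Q"
proof
  have pos: "real m powi a > 0" for a using m by auto
  have *: "of_int \<lfloor>y * c\<rfloor> / c \<le> y" "y < (of_int \<lfloor>y * c\<rfloor> + 1) / c" if "c > 0" for y c :: real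
    using that by (simp_all add: pos_divide_le_eq pos_less_divide_eq)
  let ?Q = "pcube m k (\<lambda>i. \<lfloor>fst x $ i * real m powi k\<rfloor>) \<lfloor>snd x * real m powi (2 * k)\<rfloor>"
  show "?Q \<in> pcubes m" by (rule pcube_in_pcubes)
  show "generation m ?Q = k" by (rule generation_pcube[OF m])
  show "x \<in> ?Q" using *[OF pos] by (cases x) (auto simp: pcube_def)
qed

lemma countable_pcubes: "countable (pcubes m :: ((real^'n) \<times> real) set set)"
proof -
  have "pcubes m = (\<lambda>(k, j, l). pcube m k j l :: ((real^'n) \<times> real) set) ` UNIV"
    by (auto simp: pcubes_def)
  also have "countable \<dots>" by (intro countable_image) simp
  finally show ?thesis .
qed

lemma countable_subset_pcubes:
  "T \<subseteq> (pcubes m :: ((real^'n) \<times> real) set set) \<Longrightarrow> countable T"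
  using countable_pcubes countable_subset by blast

lemma pcube_borel:
  fixes Q :: "((real^'n) \<times> real) set"
  assumes "Q \<in> pcubes m"
  shows "Q \<in> sets borel"
proof -
  obtain k j l where Q: "Q = pcube m k j l" using assms by (auto simp: pcubes_def)
  have 1: "{p :: (real^'n) \<times> real. a \<le> fst p $ i} \<in> sets borel"
    "{p :: (real^'n) \<times> real. fst p $ i < a} \<in> sets borel" for a i
    by (intro borel_closed borel_open closed_Collect_le open_Collect_less continuous_intros)+
  have 2: "{p :: (real^'n) \<times> real. a \<le> snd p} \<in> sets borel"
    "{p :: (real^'n) \<times> real. snd p < a} \<in> sets borel" for a
    by (intro borel_closed borel_open closed_Collect_le open_Collect_less continuous_intros)+
  have "Q = (\<Inter>i. {p. of_int (j i) / real m powi k \<le> fst p $ i}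
        \<inter> {p. fst p $ i < (of_int (j i) + 1) / real m powi k})
      \<inter> ({p. of_int l / real m powi (2 * k) \<le> snd p}
        \<inter> {p. snd p < (of_int l + 1) / real m powi (2 * k)})"
    unfolding Q pcube_def by auto
  also have "\<dots> \<in> sets borel"
    using 1 2 by (intro sets.Int sets.finite_INT) auto
  finally show ?thesis .
qed

lemma pcube_sets:
  fixes Q :: "((real^'n) \<times> real) set"
  assumes "radon_measure M" "Q \<in> pcubes m"
  shows "Q \<in> sets M"
  using pcube_borel[OF assms(2)] assms(1) by (simp add: radon_measure_def)

lemma emeasure_pcube_finite:
  fixes M :: "((real^'n) \<times> real) measure"
  assumes M: "radon_measure M" and Q: "Q \<in> pcubes m"
  shows "emeasure M Q < \<infinity>"
proof -
  obtain k j l where Q: "Q = pcube m k j l" using Q by (auto simp: pcubes_def)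
  define K where "K = cbox (\<chi> i. of_int (j i) / real m powi k) (\<chi> i. (of_int (j i) + 1) / real m powi k)
    \<times> {of_int l / real m powi (2 * k) .. (of_int l + 1) / real m powi (2 * k)}"
  have K: "compact K" unfolding K_def by (intro compact_Times compact_cbox compact_Icc)
  have sub: "Q \<subseteq> K" unfolding Q K_def pcube_def by (auto simp: mem_box_cart less_imp_le)
  have "K \<in> sets M" using K M by (simp add: radon_measure_def borel_compact)
  then have "emeasure M Q \<le> emeasure M K" using sub by (rule emeasure_mono[rotated])
  also have "\<dots> < \<infinity>" using M K by (auto simp: radon_measure_def)
  finally show ?thesis .
qed

text \<open>The number of space dimensions bounds the parabolic diameter of a unit cube: the
  Euclidean norm is at most the sum of the coordinates, and the square root of the time
  difference scales like a length.\<close>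

lemma parabolic_dist_pcube_le:
  fixes Q :: "((real^'n) \<times> real) set"
  assumes m: "m \<ge> 2" and Q: "Q \<in> pcubes m" and x: "x \<in> Q" and y: "y \<in> Q"
  shows "parabolic_dist x y \<le> real CARD('n) * side m Q"
proof -
  obtain k j l where Qe: "Q = pcube m k j l" and k: "generation m Q = k"
    using pcubeE[OF m Q] .
  have s: "side m Q = 1 / real m powi k" by (simp add: side_def k power_int_minus field_simps)
  have s2: "(side m Q)\<^sup>2 = 1 / real m powi (2 * k)"
    using m by (simp add: s power_divide power_int_mult mult.commute[of 2] power_int_numeral)
  have card: "1 \<le> real CARD('n)" by (simp add: Suc_le_eq)
  have close: "\<bar>u - v\<bar> \<le> 1 / c"
    if "a / c \<le> u" "u < (a + 1) / c" "a / c \<le> v" "v < (a + 1) / c" for a c u v :: real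
    using that by (simp add: add_divide_distrib)
  have "\<bar>(fst x - fst y) $ i\<bar> \<le> side m Q" for i
    using x y unfolding s unfolding Qe by (auto simp: pcube_def intro!: close[of "of_int (j i)"])
  then have "(\<Sum>i\<in>UNIV. \<bar>(fst x - fst y) $ i\<bar>) \<le> (\<Sum>i\<in>(UNIV::'n set). side m Q)"
    by (intro sum_mono)
  then have A: "norm (fst x - fst y) \<le> real CARD('n) * side m Q"
    using norm_le_l1_cart[of "fst x - fst y"] by simp
  have "\<bar>snd x - snd y\<bar> \<le> (side m Q)\<^sup>2"
    using x y unfolding s2 unfolding Qe by (auto simp: pcube_def intro!: close[of "of_int l"])
  then have "\<bar>snd x - snd y\<bar> powr (1/2) \<le> sqrt ((side m Q)\<^sup>2)"
    by (simp add: powr_half_sqrt real_sqrt_le_mono del: real_sqrt_abs real_sqrt_pow2)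
  also have "\<dots> = 1 * side m Q" using side_pos[OF m, of Q] by simp
  also have "\<dots> \<le> real CARD('n) * side m Q"
    using card side_pos[OF m, of Q] by (intro mult_right_mono) auto
  finally show ?thesis using A by (simp add: parabolic_dist_def)
qed

text \<open>Since cubes are nested or disjoint, the maximal cubes of a family already cover its
  union. A lower bound on the generations makes sure that maximal cubes exist.\<close>

lemma maximal_pcubes:
  fixes F :: "((real^'n) \<times> real) set set"
  assumes m: "m \<ge> 2" and F: "F \<subseteq> pcubes m" and gen: "\<And>Q. Q \<in> F \<Longrightarrow> k \<le> generation m Q"
  obtains G where "G \<subseteq> F" "disjoint G" "\<Union>G = \<Union>F"
proof
  define G where "G = {Q \<in> F. \<forall>R\<in>F. R \<inter> Q \<noteq> {} \<longrightarrow> generation m Q \<le> generation m R}"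
  show "G \<subseteq> F" by (auto simp: G_def)
  show "disjoint G"
  proof (rule disjointI)
    fix Q R assume QR: "Q \<in> G" "R \<in> G" "Q \<noteq> R"
    show "Q \<inter> R = {}"
    proof (rule ccontr)
      assume meet: "Q \<inter> R \<noteq> {}"
      then have meet': "R \<inter> Q \<noteq> {}" by blast
      have *: "Q \<in> F" "R \<in> F" "Q \<in> pcubes m" "R \<in> pcubes m"
        using QR F by (auto simp: G_def)
      have g: "generation m Q \<le> generation m R" "generation m R \<le> generation m Q"
        using QR * meet meet' unfolding G_def by blast+
      have "R \<subseteq> Q" "Q \<subseteq> R"
        using pcubes_nested[OF m *(3,4) g(1) meet] pcubes_nested[OF m *(4,3) g(2) meet'] by auto
      with QR(3) show False by blast
    qed
  qed
  show "\<Union>G = \<Union>F"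
  proof
    show "\<Union>F \<subseteq> \<Union>G"
    proof
      fix x assume "x \<in> \<Union>F"
      then obtain Q0 where "Q0 \<in> F \<and> x \<in> Q0" by blast
      then obtain Q where Q: "Q \<in> F" "x \<in> Q"
        and min: "\<And>R. R \<in> F \<and> x \<in> R \<Longrightarrow> nat (generation m Q - k) \<le> nat (generation m R - k)"
        using ex_has_least_nat[of "\<lambda>Q. Q \<in> F \<and> x \<in> Q" Q0 "\<lambda>Q. nat (generation m Q - k)"]
        by blast
      have "generation m Q \<le> generation m R" if R: "R \<in> F" "R \<inter> Q \<noteq> {}" for R
      proof (rule ccontr)
        assume less: "\<not> generation m Q \<le> generation m R"
        then have "Q \<subseteq> R" using R Q F by (intro pcubes_nested[OF m]) auto
        then have "nat (generation m Q - k) \<le> nat (generation m R - k)"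
          using R Q by (intro min) auto
        with less gen[OF R(1)] gen[OF Q(1)] show False by auto
      qed
      then show "x \<in> \<Union>G" using Q by (auto simp: G_def)
    qed
  qed (auto simp: G_def)
qed

section \<open>Refining covers\<close>

text \<open>With \<open>\<tau> = (n + 2) / 2 - \<beta>\<close> this is the quantity that does not grow when a cube is
  replaced by smaller ones. It interpolates between measure and side length, so that both
  hypotheses of the theorem bound it.\<close>

definition cube_weight ::
    "((real^'n) \<times> real) measure \<Rightarrow> nat \<Rightarrow> real \<Rightarrow> ((real^'n) \<times> real) set \<Rightarrow> ennreal" where
  "cube_weight M m \<tau> Q = ennreal (sqrt (measure M Q) * side m Q powr \<tau>)"

text \<open>By Cauchy--Schwarz and disjointness,
  \<open>\<Sum> \<mu>(R)\<^sup>1\<^sup>/\<^sup>2 (side R)\<^sup>\<sigma>\<^sup>/\<^sup>2 \<le> \<mu>(Q)\<^sup>1\<^sup>/\<^sup>2 (side Q)\<^sup>\<sigma>\<^sup>/\<^sup>2\<close>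
  for the maximal cubes \<open>R\<close> of an efficient cover. Raising the exponent from \<open>\<sigma>/2\<close> to
  \<open>\<tau>\<close> only helps, because the cubes of the cover are smaller than \<open>Q\<close>.\<close>

lemma refine_by_small_content:
  fixes M :: "((real^'n) \<times> real) measure"
  assumes m: "m \<ge> 2" and M: "radon_measure M" and Q: "Q \<in> pcubes m" and \<tau>: "\<sigma> / 2 \<le> \<tau>"
    and content: "net_content m \<sigma> (ennreal (side m Q / real m)) (E \<inter> Q)
      < ennreal (side m Q powr \<sigma>)"
  shows "\<exists>T\<subseteq>pcubes m. (\<forall>R\<in>T. generation m Q + 1 \<le> generation m R) \<and> E \<inter> Q \<subseteq> \<Union>T \<and>
    (\<integral>\<^sup>+R. cube_weight M m \<tau> R \<partial>count_space T) \<le> cube_weight M m \<tau> Q"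
proof -
  have sq: "0 < side m Q" using side_pos[OF m] .
  obtain I e where cov: "E \<inter> Q \<subseteq> (\<Union>i\<in>I. e i)"
    and e: "\<And>i. i \<in> I \<Longrightarrow> e i \<in> pcubes m \<and> ennreal (side m (e i)) \<le> ennreal (side m Q / real m)"
    and sum: "(\<Sum>i::nat. if i \<in> I then ennreal (side m (e i) powr \<sigma>) else 0)
      < ennreal (side m Q powr \<sigma>)"
    using content unfolding net_content_def INF_less_iff by auto
  define F where "F = {R \<in> e ` I. Q \<inter> R \<noteq> {}}"
  have F: "F \<subseteq> pcubes m" using e by (auto simp: F_def)
  have genF: "generation m Q + 1 \<le> generation m R" if "R \<in> F" for R
    using that e sq by (auto simp: F_def side_le_div_iff[OF m, symmetric])
  obtain T where T: "T \<subseteq> F" "disjoint T" "\<Union>T = \<Union>F"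
    using maximal_pcubes[OF m F genF] .
  have Tp: "T \<subseteq> pcubes m" using T F by blast
  have cT: "countable T" using Tp by (rule countable_subset_pcubes)
  have TM: "T \<subseteq> sets M" using Tp pcube_sets[OF M] by blast
  have "R \<subseteq> Q" if "R \<in> F" for R
    using that genF[OF that] F Q by (intro pcubes_nested[OF m]) (auto simp: F_def)
  then have sub: "\<Union>T \<subseteq> Q" using T by blast
  have QM: "Q \<in> sets M" using Q by (rule pcube_sets[OF M])
  have fin: "emeasure M R = ennreal (measure M R)" if "R \<in> pcubes m" for R
    using emeasure_pcube_finite[OF M that] by (intro emeasure_eq_ennreal_measure) auto
  let ?f = "\<lambda>R. ennreal (sqrt (measure M R))"
  let ?g = "\<lambda>R. ennreal (side m R powr (\<sigma> / 2))"
  have "(\<integral>\<^sup>+R. ?f R ^ 2 \<partial>count_space T) = (\<integral>\<^sup>+R. emeasure M R \<partial>count_space T)"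
    using Tp by (intro nn_integral_cong) (auto simp: ennreal_power fin)
  also have "\<dots> = emeasure M (\<Union>T)"
    by (rule emeasure_disjoint_Union[OF cT TM T(2)])
  also have "\<dots> \<le> emeasure M Q" using sub QM by (rule emeasure_mono)
  finally have f2: "(\<integral>\<^sup>+R. ?f R ^ 2 \<partial>count_space T) \<le> ennreal (measure M Q)"
    by (simp add: fin[OF Q])
  have sqr: "(side m R powr (\<sigma> / 2))\<^sup>2 = side m R powr \<sigma>" for R :: "((real^'n) \<times> real) set"
    by (simp add: power2_eq_square flip: powr_add)
  have "(\<integral>\<^sup>+R. ?g R ^ 2 \<partial>count_space T) = (\<integral>\<^sup>+R. ennreal (side m R powr \<sigma>) \<partial>count_space T)"
    by (intro nn_integral_cong) (simp add: ennreal_power sqr)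
  also have "\<dots> \<le> (\<integral>\<^sup>+R. ennreal (side m R powr \<sigma>) \<partial>count_space (e ` I))"
    using T by (intro nn_integral_count_space_mono_set) (auto simp: F_def)
  also have "\<dots> \<le> (\<Sum>i. if i \<in> I then ennreal (side m (e i) powr \<sigma>) else 0)"
    by (rule nn_integral_image_le)
  finally have g2: "(\<integral>\<^sup>+R. ?g R ^ 2 \<partial>count_space T) \<le> ennreal (side m Q powr \<sigma>)"
    using sum by simp
  have "(\<integral>\<^sup>+R. ?f R * ?g R \<partial>count_space T)\<^sup>2
      \<le> (\<integral>\<^sup>+R. ?f R ^ 2 \<partial>count_space T) * (\<integral>\<^sup>+R. ?g R ^ 2 \<partial>count_space T)"
    by (rule Cauchy_Schwarz_nn_integral) auto
  also have "\<dots> \<le> ennreal (measure M Q) * ennreal (side m Q powr \<sigma>)"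
    using f2 g2 by (rule mult_mono) auto
  also have "\<dots> = ennreal ((sqrt (measure M Q) * side m Q powr (\<sigma> / 2))\<^sup>2)"
    by (simp add: power_mult_distrib sqr ennreal_mult)
  finally have fg: "(\<integral>\<^sup>+R. ?f R * ?g R \<partial>count_space T)
      \<le> ennreal (sqrt (measure M Q) * side m Q powr (\<sigma> / 2))"
    by (rule ennreal_le_if_power2_le) simp
  have "(\<integral>\<^sup>+R. cube_weight M m \<tau> R \<partial>count_space T)
      \<le> (\<integral>\<^sup>+R. ennreal (side m Q powr (\<tau> - \<sigma> / 2)) * (?f R * ?g R) \<partial>count_space T)"
  proof (rule nn_integral_mono)
    fix R assume "R \<in> space (count_space T)"
    then have "generation m Q \<le> generation m R" using genF T by force
    then have "side m R \<le> side m Q" by (simp add: side_le_iff[OF m])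
    then have "side m R powr (\<tau> - \<sigma> / 2) \<le> side m Q powr (\<tau> - \<sigma> / 2)"
      using \<tau> side_pos[OF m, of R] by (intro powr_mono2) auto
    then have "sqrt (measure M R) * side m R powr (\<sigma> / 2) * side m R powr (\<tau> - \<sigma> / 2)
        \<le> sqrt (measure M R) * side m R powr (\<sigma> / 2) * side m Q powr (\<tau> - \<sigma> / 2)"
      by (intro mult_left_mono) auto
    also have "sqrt (measure M R) * side m R powr (\<sigma> / 2) * side m R powr (\<tau> - \<sigma> / 2)
        = sqrt (measure M R) * side m R powr \<tau>"
      by (simp add: mult.assoc flip: powr_add)
    finally have "cube_weight M m \<tau> R
        \<le> ennreal (sqrt (measure M R) * side m R powr (\<sigma> / 2) * side m Q powr (\<tau> - \<sigma> / 2))"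
      unfolding cube_weight_def by (rule ennreal_leI)
    also have "\<dots> = ennreal (side m Q powr (\<tau> - \<sigma> / 2)) * (?f R * ?g R)"
      by (simp add: ennreal_mult mult_ac)
    finally show "cube_weight M m \<tau> R \<le> \<dots>" .
  qed
  also have "\<dots> = ennreal (side m Q powr (\<tau> - \<sigma> / 2)) * (\<integral>\<^sup>+R. ?f R * ?g R \<partial>count_space T)"
    by (rule nn_integral_cmult) simp
  also have "\<dots> \<le> ennreal (side m Q powr (\<tau> - \<sigma> / 2))
      * ennreal (sqrt (measure M Q) * side m Q powr (\<sigma> / 2))"
    by (rule mult_left_mono[OF fg]) simp
  also have "\<dots> = ennreal (sqrt (measure M Q) * (side m Q powr (\<tau> - \<sigma> / 2) * side m Q powr (\<sigma> / 2)))"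
    by (simp add: mult_ac flip: ennreal_mult)
  also have "\<dots> = cube_weight M m \<tau> Q"
    by (simp add: cube_weight_def flip: powr_add)
  finally have "(\<integral>\<^sup>+R. cube_weight M m \<tau> R \<partial>count_space T) \<le> cube_weight M m \<tau> Q" .
  moreover have "E \<inter> Q \<subseteq> \<Union>T" unfolding T(3) F_def using cov by blast
  ultimately show ?thesis using Tp genF T(1) by blast
qed

text \<open>Here the weight gains a factor \<open>m\<^sup>\<beta>\<close> from the smaller sides and loses \<open>m\<^sup>-\<^sup>\<lambda>\<close>
  by hypothesis.\<close>

lemma refine_by_children:
  fixes M :: "((real^'n) \<times> real) measure"
  assumes m: "m \<ge> 2" and Q: "Q \<in> pcubes m" and \<beta>: "\<beta> \<le> lam"
    and children: "(\<Sum>R\<in>Child m Q. measure M R powr (1/2) * vol m R powr (1/2))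
      \<le> real m powr (- lam) * measure M Q powr (1/2) * vol m Q powr (1/2)"
  defines "\<tau> \<equiv> (real CARD('n) + 2) / 2 - \<beta>"
  shows "\<exists>T\<subseteq>pcubes m. (\<forall>R\<in>T. generation m Q + 1 \<le> generation m R) \<and> Q \<subseteq> \<Union>T \<and>
    (\<integral>\<^sup>+R. cube_weight M m \<tau> R \<partial>count_space T) \<le> cube_weight M m \<tau> Q"
proof (intro exI[of _ "Child m Q"] conjI ballI)
  show "Child m Q \<subseteq> pcubes m" by (auto simp: Child_def)
  show "generation m Q + 1 \<le> generation m R" if "R \<in> Child m Q" for R
    using that by (simp add: Child_def)
  show "Q \<subseteq> \<Union>(Child m Q)"
  proof
    fix x assume x: "x \<in> Q"
    obtain R where R: "R \<in> pcubes m" "generation m R = generation m Q + 1" "x \<in> R"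
      using pcube_containing[OF m] .
    then have "R \<subseteq> Q" using x by (intro pcubes_nested[OF m Q]) auto
    with R show "x \<in> \<Union>(Child m Q)" by (auto simp: Child_def)
  qed
  have sq: "0 < side m Q" using side_pos[OF m] .
  define s where "s = side m Q / real m"
  have s: "0 < s" using sq m by (simp add: s_def)
  have half: "vol m R powr (1/2) = side m R powr (\<tau> + \<beta>)" for R :: "((real^'n) \<times> real) set"
    by (simp add: vol_eq_side_powr[OF m] powr_powr \<tau>_def)
  have sR: "side m R = s" if "R \<in> Child m Q" for R
    using that m by (simp add: Child_def side_def s_def power_int_diff)
  have "(\<Sum>R\<in>Child m Q. sqrt (measure M R) * side m R powr \<tau>)
      = (\<Sum>R\<in>Child m Q. s powr (- \<beta>) * (measure M R powr (1/2) * vol m R powr (1/2)))"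
    by (intro sum.cong refl)
       (simp add: sR half powr_half_sqrt mult.left_commute[of "s powr _"] flip: powr_add)
  also have "\<dots> \<le> s powr (- \<beta>) * (real m powr (- lam) * measure M Q powr (1/2) * vol m Q powr (1/2))"
    unfolding sum_distrib_left[symmetric] by (rule mult_left_mono[OF children]) simp
  also have "\<dots> = real m powr (\<beta> - lam) * (sqrt (measure M Q) * side m Q powr \<tau>)"
  proof -
    have "s powr (- \<beta>) = side m Q powr (- \<beta>) * real m powr \<beta>"
      using sq m by (simp add: s_def powr_divide powr_minus field_simps)
    moreover have "side m Q powr (- \<beta>) * side m Q powr (\<tau> + \<beta>) = side m Q powr \<tau>"
      by (simp flip: powr_add)
    moreover have "real m powr (\<beta> - lam) = real m powr \<beta> * real m powr (- lam)"
      by (simp flip: powr_add)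
    ultimately show ?thesis by (simp add: half powr_half_sqrt mult_ac)
  qed
  also have "\<dots> \<le> 1 * (sqrt (measure M Q) * side m Q powr \<tau>)"
  proof (rule mult_right_mono)
    have "real m powr (\<beta> - lam) \<le> real m powr 0" using m \<beta> by (intro powr_mono) auto
    then show "real m powr (\<beta> - lam) \<le> 1" using m by simp
  qed simp
  finally have "(\<Sum>R\<in>Child m Q. sqrt (measure M R) * side m R powr \<tau>)
      \<le> sqrt (measure M Q) * side m Q powr \<tau>" by simp
  then show "(\<integral>\<^sup>+R. cube_weight M m \<tau> R \<partial>count_space (Child m Q)) \<le> cube_weight M m \<tau> Q"
    by (simp add: nn_integral_count_space_finite card_Child(2)[OF m Q] cube_weight_def
        sum_ennreal ennreal_leI)
qed

lemma refine_repeatedly: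
  fixes M :: "((real^'n) \<times> real) measure"
  assumes step: "\<And>Q. Q \<in> pcubes m \<Longrightarrow> 0 \<le> generation m Q \<Longrightarrow>
      \<exists>T\<subseteq>pcubes m. (\<forall>R\<in>T. generation m Q + 1 \<le> generation m R) \<and> E \<inter> Q \<subseteq> \<Union>T \<and>
        (\<integral>\<^sup>+R. cube_weight M m \<tau> R \<partial>count_space T) \<le> cube_weight M m \<tau> Q"
    and Q: "Q \<in> pcubes m" "0 \<le> generation m Q"
  shows "\<exists>T\<subseteq>pcubes m. (\<forall>R\<in>T. generation m Q + int k \<le> generation m R) \<and> E \<inter> Q \<subseteq> \<Union>T \<and>
    (\<integral>\<^sup>+R. cube_weight M m \<tau> R \<partial>count_space T) \<le> cube_weight M m \<tau> Q"
proof (induction k)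
  case 0
  show ?case using Q by (intro exI[of _ "{Q}"]) (auto simp: nn_integral_count_space_finite)
next
  case (Suc k)
  then obtain T where T: "T \<subseteq> pcubes m" "\<And>R. R \<in> T \<Longrightarrow> generation m Q + int k \<le> generation m R"
      "E \<inter> Q \<subseteq> \<Union>T" "(\<integral>\<^sup>+R. cube_weight M m \<tau> R \<partial>count_space T) \<le> cube_weight M m \<tau> Q"
    by blast
  let ?ok = "\<lambda>P S. S \<subseteq> pcubes m \<and> (\<forall>R\<in>S. generation m P + 1 \<le> generation m R) \<and> E \<inter> P \<subseteq> \<Union>S \<and>
        (\<integral>\<^sup>+R. cube_weight M m \<tau> R \<partial>count_space S) \<le> cube_weight M m \<tau> P"
  have "\<exists>S. ?ok P S" if P: "P \<in> T" for P
  proof (rule step)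
    show "P \<in> pcubes m" using P T(1) by blast
    show "0 \<le> generation m P" using T(2)[OF P] Q by linarith
  qed
  then obtain S where ok: "\<And>P. P \<in> T \<Longrightarrow> ?ok P (S P)" by metis
  have S: "S P \<subseteq> pcubes m" "\<And>R. R \<in> S P \<Longrightarrow> generation m P + 1 \<le> generation m R"
    "E \<inter> P \<subseteq> \<Union>(S P)"
    "(\<integral>\<^sup>+R. cube_weight M m \<tau> R \<partial>count_space (S P)) \<le> cube_weight M m \<tau> P"
    if "P \<in> T" for P
    using ok[OF that] by blast+
  have "(\<integral>\<^sup>+R. cube_weight M m \<tau> R \<partial>count_space (\<Union>P\<in>T. S P))
      \<le> (\<integral>\<^sup>+P. (\<integral>\<^sup>+R. cube_weight M m \<tau> R \<partial>count_space (S P)) \<partial>count_space T)"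
    using T(1) by (intro nn_integral_count_space_UN_le countable_subset_pcubes)
  also have "\<dots> \<le> (\<integral>\<^sup>+P. cube_weight M m \<tau> P \<partial>count_space T)"
    using S(4) by (intro nn_integral_mono) auto
  also note T(4)
  finally have "(\<integral>\<^sup>+R. cube_weight M m \<tau> R \<partial>count_space (\<Union>P\<in>T. S P)) \<le> cube_weight M m \<tau> Q" .
  moreover have "\<forall>R\<in>(\<Union>P\<in>T. S P). generation m Q + int (Suc k) \<le> generation m R"
    using T(2) S(2) by fastforce
  moreover have "E \<inter> Q \<subseteq> \<Union>(\<Union>P\<in>T. S P)" using T(3) S(3) by blast
  ultimately show ?case using S(1) by (intro exI[of _ "\<Union>P\<in>T. S P"]) blast
qed

text \<open>A light cube \<open>R\<close> satisfies
  \<open>\<mu>(R) \<le> \<mu>(R)\<^sup>1\<^sup>/\<^sup>2 (side R)\<^sup>\<tau> (side R)\<^sup>\<epsilon>\<close> with \<open>\<epsilon> = s/2 - \<tau>\<close>. Summing over covers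
  of bounded weight by ever smaller cubes, the factor \<open>(side R)\<^sup>\<epsilon>\<close> forces \<open>\<mu>(B) = 0\<close>.\<close>

lemma null_if_cubes_light:
  fixes M :: "((real^'n) \<times> real) measure"
  assumes m: "m \<ge> 2" and M: "radon_measure M" and s: "\<tau> < s / 2"
    and k0: "0 \<le> k0" and W: "W < \<infinity>"
    and covers: "\<And>k::nat. \<exists>T\<subseteq>pcubes m. (\<forall>R\<in>T. k0 + int k \<le> generation m R) \<and> B \<subseteq> \<Union>T \<and>
      (\<integral>\<^sup>+R. cube_weight M m \<tau> R \<partial>count_space T) \<le> W"
    and light: "\<And>R. R \<in> pcubes m \<Longrightarrow> k0 \<le> generation m R \<Longrightarrow> R \<inter> B \<noteq> {} \<Longrightarrow>
      measure M R \<le> side m R powr s"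
  shows "emeasure M B = 0"
proof -
  define \<epsilon> where "\<epsilon> = s / 2 - \<tau>"
  define q where "q = (1 / real m) powr \<epsilon>"
  have \<epsilon>: "0 < \<epsilon>" using s by (simp add: \<epsilon>_def)
  have q: "0 \<le> q" "q < 1"
    using powr_less_mono2[of \<epsilon> "1 / real m" 1] m \<epsilon> by (auto simp: q_def)
  have bound: "emeasure M B \<le> ennreal (q ^ k) * W" for k
  proof -
    obtain T where T: "T \<subseteq> pcubes m" "\<And>R. R \<in> T \<Longrightarrow> k0 + int k \<le> generation m R" "B \<subseteq> \<Union>T"
      "(\<integral>\<^sup>+R. cube_weight M m \<tau> R \<partial>count_space T) \<le> W"
      using covers[of k] by blast
    define T' where "T' = {R \<in> T. R \<inter> B \<noteq> {}}"
    have T': "T' \<subseteq> T" "B \<subseteq> \<Union>T'" using T(3) by (auto simp: T'_def)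
    have cT': "countable T'" using T' T(1) by (intro countable_subset_pcubes[of _ m]) auto
    have T'M: "T' \<subseteq> sets M" using T' T(1) pcube_sets[OF M] by blast
    have "emeasure M B \<le> emeasure M (\<Union>T')"
      using T'(2) cT' T'M by (intro emeasure_mono sets.countable_Union)
    also have "\<dots> \<le> (\<integral>\<^sup>+R. emeasure M R \<partial>count_space T')"
      by (rule emeasure_Union_le_nn_integral[OF cT' T'M])
    also have "\<dots> \<le> (\<integral>\<^sup>+R. ennreal (q ^ k) * cube_weight M m \<tau> R \<partial>count_space T')"
    proof (rule nn_integral_mono)
      fix R assume "R \<in> space (count_space T')"
      then have R: "R \<in> pcubes m" "k0 + int k \<le> generation m R" "R \<inter> B \<noteq> {}"
        using T(1,2) by (auto simp: T'_def)
      have sR: "0 < side m R" using side_pos[OF m] .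
      have "side m R \<le> (1 / real m) ^ k" using R k0 by (intro side_le_power[OF m]) auto
      then have "side m R powr \<epsilon> \<le> ((1 / real m) ^ k) powr \<epsilon>"
        using sR \<epsilon> by (intro powr_mono2) auto
      also have "\<dots> = q ^ k"
        using m by (simp add: q_def powr_powr mult.commute flip: powr_realpow)
      finally have eps: "side m R powr \<epsilon> \<le> q ^ k" .
      have "measure M R \<le> side m R powr s" using R k0 by (intro light) auto
      then have "sqrt (measure M R) \<le> side m R powr (s / 2)"
        using real_sqrt_le_mono[of "measure M R" "side m R powr s"]
        by (simp add: powr_powr flip: powr_half_sqrt)
      also have "\<dots> = side m R powr \<tau> * side m R powr \<epsilon>"
        by (simp add: \<epsilon>_def flip: powr_add)
      also have "\<dots> \<le> side m R powr \<tau> * q ^ k"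
        by (rule mult_left_mono[OF eps]) simp
      finally have "sqrt (measure M R) * sqrt (measure M R)
          \<le> sqrt (measure M R) * (side m R powr \<tau> * q ^ k)"
        by (intro mult_left_mono) auto
      then have "measure M R \<le> q ^ k * (sqrt (measure M R) * side m R powr \<tau>)"
        by (simp add: mult_ac)
      then have "ennreal (measure M R) \<le> ennreal (q ^ k) * cube_weight M m \<tau> R"
        unfolding cube_weight_def using q
        by (subst ennreal_mult[symmetric]) (auto intro: ennreal_leI)
      moreover have "emeasure M R = ennreal (measure M R)"
        using emeasure_pcube_finite[OF M R(1)] by (intro emeasure_eq_ennreal_measure) auto
      ultimately show "emeasure M R \<le> ennreal (q ^ k) * cube_weight M m \<tau> R" by simp
    qed
    also have "\<dots> \<le> (\<integral>\<^sup>+R. ennreal (q ^ k) * cube_weight M m \<tau> R \<partial>count_space T)"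
      using T'(1) by (rule nn_integral_count_space_mono_set)
    also have "\<dots> = ennreal (q ^ k) * (\<integral>\<^sup>+R. cube_weight M m \<tau> R \<partial>count_space T)"
      by (rule nn_integral_cmult) simp
    also have "\<dots> \<le> ennreal (q ^ k) * W"
      by (rule mult_left_mono[OF T(4)]) simp
    finally show ?thesis .
  qed
  obtain w where w: "W = ennreal w" "0 \<le> w" using W by (cases W) auto
  have "(\<lambda>k. q ^ k * w) \<longlonglongrightarrow> 0 * w"
    using q by (intro tendsto_mult tendsto_const LIMSEQ_realpow_zero) auto
  then have "(\<lambda>k. ennreal (q ^ k * w)) \<longlonglongrightarrow> ennreal 0" by (intro tendsto_ennrealI) simp
  moreover have "emeasure M B \<le> ennreal (q ^ k * w)" for k
    using bound[of k] w q by (simp add: ennreal_mult)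
  ultimately have "emeasure M B \<le> ennreal 0" by (intro LIMSEQ_le_const) auto
  then show ?thesis by simp
qed

section \<open>Points in heavy cubes of every scale\<close>

text \<open>The limit superior of the family of heavy cubes: up to constants, the points at which
  the upper \<open>s\<close>-density of \<open>M\<close> is bounded away from 0.\<close>

definition heavy_points ::
    "((real^'n) \<times> real) measure \<Rightarrow> nat \<Rightarrow> real \<Rightarrow> ((real^'n) \<times> real) set" where
  "heavy_points M m s = (\<Inter>k::nat. \<Union>{Q \<in> pcubes m. int k \<le> generation m Q \<and>
      side m Q powr s < measure M Q})"

lemma heavy_points_borel: "heavy_points M m s \<in> sets borel"
proof -
  have "\<Union>{Q \<in> pcubes m. int k \<le> generation m Q \<and> side m Q powr s < measure M Q} \<in> sets borel"
    for k
    by (intro sets.countable_Union countable_subset_pcubes[of _ m]) (auto intro: pcube_borel)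
  then show ?thesis unfolding heavy_points_def by (intro sets.countable_INT'') auto
qed

text \<open>The maximal heavy cubes inside \<open>P\<close> are disjoint and satisfy
  \<open>(side R)\<^sup>s < \<mu>(R)\<close>, so their \<open>s\<close>-th powers add up to at most \<open>\<mu>(P)\<close>.\<close>

lemma cover_heavy_points_in_cube:
  fixes M :: "((real^'n) \<times> real) measure"
  assumes m: "m \<ge> 2" and M: "radon_measure M" and s: "s \<le> s'"
    and P: "P \<in> pcubes m" "generation m P \<le> int k"
  shows "\<exists>T\<subseteq>pcubes m. (\<forall>R\<in>T. int k \<le> generation m R) \<and> heavy_points M m s \<inter> P \<subseteq> \<Union>T \<and>
    (\<integral>\<^sup>+R. ennreal (side m R powr s') \<partial>count_space T)
      \<le> ennreal (((1 / real m) ^ k) powr (s' - s) * measure M P)"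
proof -
  define F where "F = {Q \<in> pcubes m. int k \<le> generation m Q \<and> side m Q powr s < measure M Q
      \<and> P \<inter> Q \<noteq> {}}"
  have F: "F \<subseteq> pcubes m" "\<And>Q. Q \<in> F \<Longrightarrow> int k \<le> generation m Q" by (auto simp: F_def)
  obtain T where T: "T \<subseteq> F" "disjoint T" "\<Union>T = \<Union>F"
    using maximal_pcubes[OF m F] .
  have Tp: "T \<subseteq> pcubes m" using T by (auto simp: F_def)
  have cT: "countable T" using Tp by (rule countable_subset_pcubes)
  have TM: "T \<subseteq> sets M" using Tp pcube_sets[OF M] by blast
  have fin: "emeasure M R = ennreal (measure M R)" if "R \<in> pcubes m" for R
    using emeasure_pcube_finite[OF M that] by (intro emeasure_eq_ennreal_measure) auto
  have "R \<subseteq> P" if "R \<in> F" for R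
    using that P by (intro pcubes_nested[OF m]) (auto simp: F_def)
  then have sub: "\<Union>T \<subseteq> P" using T by blast
  define q where "q = ((1 / real m) ^ k) powr (s' - s)"
  have "(\<integral>\<^sup>+R. ennreal (side m R powr s') \<partial>count_space T)
      \<le> (\<integral>\<^sup>+R. ennreal q * emeasure M R \<partial>count_space T)"
  proof (rule nn_integral_mono)
    fix R assume "R \<in> space (count_space T)"
    then have R: "R \<in> pcubes m" "int k \<le> generation m R" "side m R powr s < measure M R"
      using T by (auto simp: F_def)
    have "side m R powr (s' - s) \<le> q"
      unfolding q_def using s side_pos[OF m, of R] side_le_power[OF m R(2)] by (intro powr_mono2) auto
    then have "side m R powr (s' - s) * side m R powr s \<le> q * measure M R"
      using R(3) by (intro mult_mono) (auto simp: q_def)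
    then have "ennreal (side m R powr s') \<le> ennreal (q * measure M R)"
      by (intro ennreal_leI) (simp flip: powr_add)
    also have "\<dots> = ennreal q * emeasure M R"
      by (simp add: fin[OF R(1)] q_def ennreal_mult)
    finally show "ennreal (side m R powr s') \<le> \<dots>" .
  qed
  also have "\<dots> = ennreal q * (\<integral>\<^sup>+R. emeasure M R \<partial>count_space T)"
    by (rule nn_integral_cmult) simp
  also have "\<dots> = ennreal q * emeasure M (\<Union>T)"
    by (simp only: emeasure_disjoint_Union[OF cT TM T(2)])
  also have "\<dots> \<le> ennreal q * emeasure M P"
    using sub pcube_sets[OF M P(1)] by (intro mult_left_mono emeasure_mono) auto
  also have "\<dots> = ennreal (q * measure M P)"
    by (simp add: fin[OF P(1)] q_def ennreal_mult)
  finally have "(\<integral>\<^sup>+R. ennreal (side m R powr s') \<partial>count_space T) \<le> ennreal (q * measure M P)" .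
  moreover have "heavy_points M m s \<inter> P \<subseteq> \<Union>T"
    unfolding T(3) F_def heavy_points_def by blast
  ultimately show ?thesis using Tp T(1) unfolding q_def F_def by blast
qed

lemma diam_pow_pcube_le:
  fixes Q :: "((real^'n) \<times> real) set"
  assumes m: "m \<ge> 2" and Q: "Q \<in> pcubes m" and s: "0 < s"
  shows "diam_pow parabolic_dist s Q \<le> (real CARD('n) * side m Q) powr s"
proof (cases "Q = {}")
  case False
  let ?d = "\<lambda>(x, y). parabolic_dist x y :: real"
  have le: "?d z \<le> real CARD('n) * side m Q" if "z \<in> Q \<times> Q" for z
    using that parabolic_dist_pcube_le[OF m Q] by auto
  then have up: "Sup (?d ` (Q \<times> Q)) \<le> real CARD('n) * side m Q"
    using False by (intro cSUP_least) auto
  obtain x where x: "x \<in> Q" using False by blast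
  have "?d (x, x) \<le> Sup (?d ` (Q \<times> Q))"
    using le x by (intro cSUP_upper bdd_aboveI2) auto
  then have "0 \<le> Sup (?d ` (Q \<times> Q))" by (simp add: parabolic_dist_def)
  with up s show ?thesis using False by (auto simp: diam_pow_def intro: powr_mono2)
qed (simp add: diam_pow_def)

text \<open>The measure may be infinite, but each of the countably many unit cubes has finite
  measure. The scale from which heavy cubes are used depends on the unit cube, so that the
  errors form a geometric series.\<close>

lemma hausdorff_measure_heavy_points:
  fixes M :: "((real^'n) \<times> real) measure"
  assumes m: "m \<ge> 2" and M: "radon_measure M" and s: "s < s'" "0 < s'"
  shows "hausdorff_measure parabolic_dist s' (heavy_points M m s) = 0"
proof -
  define C where "C = real CARD('n)"
  have C: "0 < C" by (simp add: C_def)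
  have content: "hausdorff_content parabolic_dist s' \<delta> (heavy_points M m s) \<le> 0 + ennreal \<eta>"
    if \<delta>: "0 < \<delta>" and \<eta>: "0 < \<eta>" for \<delta> \<eta> :: real
  proof -
    define \<P> :: "((real^'n) \<times> real) set set" where "\<P> = {P \<in> pcubes m. generation m P = 0}"
    have c\<P>: "countable \<P>" by (rule countable_subset_pcubes[of _ m]) (auto simp: \<P>_def)
    define err where "err i = \<eta> * (1/2) ^ Suc i" for i :: nat
    have err: "0 < err i" for i using \<eta> by (simp add: err_def)
    have "\<exists>k::nat. C * (1 / real m) ^ k \<le> \<delta> \<and>
        C powr s' * (((1 / real m) ^ k) powr (s' - s) * measure M P) \<le> err (to_nat_on \<P> P)" for P
    proof -
      have lim: "(\<lambda>k. (1 / real m) ^ k) \<longlonglongrightarrow> 0" using m by (intro LIMSEQ_realpow_zero) auto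
      have "(\<lambda>k. C * (1 / real m) ^ k) \<longlonglongrightarrow> C * 0" by (intro tendsto_intros lim)
      then have 1: "\<forall>\<^sub>F k in sequentially. C * (1 / real m) ^ k < \<delta>"
        using \<delta> by (intro order_tendstoD) auto
      have "(\<lambda>k. C powr s' * (((1 / real m) ^ k) powr (s' - s) * measure M P))
          \<longlonglongrightarrow> C powr s' * (0 powr (s' - s) * measure M P)"
        using s by (intro tendsto_mult tendsto_const tendsto_powr' lim) auto
      then have 2: "\<forall>\<^sub>F k in sequentially.
          C powr s' * (((1 / real m) ^ k) powr (s' - s) * measure M P) < err (to_nat_on \<P> P)"
        using err by (intro order_tendstoD) auto
      from eventually_happens[OF eventually_conj[OF 1 2]] show ?thesis
        by (auto intro: less_imp_le)
    qed
    then obtain k :: "((real^'n) \<times> real) set \<Rightarrow> nat" where k: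
      "\<And>P. C * (1 / real m) ^ k P \<le> \<delta>"
      "\<And>P. C powr s' * (((1 / real m) ^ k P) powr (s' - s) * measure M P) \<le> err (to_nat_on \<P> P)"
      by metis
    let ?ok = "\<lambda>P T. T \<subseteq> pcubes m \<and> (\<forall>R\<in>T. int (k P) \<le> generation m R) \<and>
      heavy_points M m s \<inter> P \<subseteq> \<Union>T \<and>
      (\<integral>\<^sup>+R. ennreal (side m R powr s') \<partial>count_space T)
        \<le> ennreal (((1 / real m) ^ k P) powr (s' - s) * measure M P)"
    have "\<exists>T. ?ok P T" if "P \<in> \<P>" for P
      using that s by (intro cover_heavy_points_in_cube[OF m M]) (auto simp: \<P>_def)
    then obtain T where ok: "\<And>P. P \<in> \<P> \<Longrightarrow> ?ok P (T P)" by metis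
    have T: "T P \<subseteq> pcubes m" "\<And>R. R \<in> T P \<Longrightarrow> int (k P) \<le> generation m R"
      "heavy_points M m s \<inter> P \<subseteq> \<Union>(T P)"
      "(\<integral>\<^sup>+R. ennreal (side m R powr s') \<partial>count_space (T P))
        \<le> ennreal (((1 / real m) ^ k P) powr (s' - s) * measure M P)" if "P \<in> \<P>" for P
      using ok[OF that] by blast+
    define \<T> where "\<T> = (\<Union>P\<in>\<P>. T P)"
    have \<T>: "\<T> \<subseteq> pcubes m" using T(1) by (auto simp: \<T>_def)
    have small: "C * side m R \<le> \<delta>" if R: "R \<in> \<T>" for R
    proof -
      obtain P where P: "P \<in> \<P>" "R \<in> T P" using R by (auto simp: \<T>_def)
      have "C * side m R \<le> C * (1 / real m) ^ k P"
        using C by (intro mult_left_mono side_le_power[OF m] T(2)[OF P]) auto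
      also note k(1)
      finally show ?thesis .
    qed
    define f :: "((real^'n) \<times> real) set \<Rightarrow> ennreal" where
      "f Q = (if Q = {} then 0 else ennreal ((C * side m Q) powr s'))" for Q
    have f: "f Q \<le> ennreal (C powr s') * ennreal (side m Q powr s')" for Q
      using C side_pos[OF m, of Q] by (simp add: f_def powr_mult flip: ennreal_mult)
    have "(\<integral>\<^sup>+Q. f Q \<partial>count_space \<T>)
        \<le> (\<integral>\<^sup>+P. (\<integral>\<^sup>+Q. f Q \<partial>count_space (T P)) \<partial>count_space \<P>)"
      unfolding \<T>_def by (rule nn_integral_count_space_UN_le[OF c\<P>])
    also have "\<dots> \<le> (\<integral>\<^sup>+P. ennreal (err (to_nat_on \<P> P)) \<partial>count_space \<P>)"
    proof (rule nn_integral_mono)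
      fix P assume "P \<in> space (count_space \<P>)"
      then have P: "P \<in> \<P>" by simp
      have "(\<integral>\<^sup>+Q. f Q \<partial>count_space (T P))
          \<le> (\<integral>\<^sup>+Q. ennreal (C powr s') * ennreal (side m Q powr s') \<partial>count_space (T P))"
        by (intro nn_integral_mono f)
      also have "\<dots> = ennreal (C powr s') * (\<integral>\<^sup>+Q. ennreal (side m Q powr s') \<partial>count_space (T P))"
        by (rule nn_integral_cmult) simp
      also have "\<dots> \<le> ennreal (C powr s')
          * ennreal (((1 / real m) ^ k P) powr (s' - s) * measure M P)"
        by (intro mult_left_mono T(4)[OF P]) simp
      also have "\<dots> = ennreal (C powr s' * (((1 / real m) ^ k P) powr (s' - s) * measure M P))"
        by (intro ennreal_mult[symmetric]) auto
      also have "\<dots> \<le> ennreal (err (to_nat_on \<P> P))" by (intro ennreal_leI k(2))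
      finally show "(\<integral>\<^sup>+Q. f Q \<partial>count_space (T P)) \<le> \<dots>" .
    qed
    also have "\<dots> = (\<integral>\<^sup>+i. ennreal (err i) \<partial>count_space (to_nat_on \<P> ` \<P>))"
      using c\<P> by (intro nn_integral_bij_count_space inj_on_imp_bij_betw inj_on_to_nat_on)
    also have "\<dots> \<le> (\<integral>\<^sup>+i. ennreal (err i) \<partial>count_space UNIV)"
      by (rule nn_integral_count_space_mono_set) simp
    also have "\<dots> = (\<Sum>i. ennreal (err i))" by (rule nn_integral_count_space_nat)
    also have "\<dots> = ennreal \<eta>"
    proof -
      have "err sums (\<eta> * 1)" unfolding err_def by (intro sums_mult power_half_series)
      then show ?thesis using err by (subst suminf_ennreal_eq) (auto intro: less_imp_le)
    qed
    finally have total: "(\<integral>\<^sup>+Q. f Q \<partial>count_space \<T>) \<le> ennreal \<eta>" .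
    have f0: "f {} = 0" by (simp add: f_def)
    obtain U where U: "\<Union>\<T> = (\<Union>i::nat. U i)" "\<And>i. U i = {} \<or> U i \<in> \<T>"
        "(\<Sum>i. f (U i)) \<le> (\<integral>\<^sup>+Q. f Q \<partial>count_space \<T>)"
      by (rule countable_family_as_sequence[of \<T> f, OF countable_subset_pcubes[OF \<T>] f0])
        (rule that)
    have "heavy_points M m s \<subseteq> \<Union>\<T>"
    proof
      fix x assume x: "x \<in> heavy_points M m s"
      obtain P where "P \<in> pcubes m" "generation m P = 0" "x \<in> P"
        using pcube_containing[OF m] .
      then have "P \<in> \<P>" "x \<in> P" by (auto simp: \<P>_def)
      then have "x \<in> \<Union>(T P)" "T P \<subseteq> \<T>" using x T(3)[of P] by (auto simp: \<T>_def)
      then show "x \<in> \<Union>\<T>" by blast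
    qed
    moreover have "parabolic_dist x y \<le> \<delta>" if xy: "x \<in> U i" "y \<in> U i" for i x y
    proof -
      have "U i \<in> \<T>" using U(2) xy by fastforce
      then show ?thesis
        using parabolic_dist_pcube_le[OF m _ xy] small[of "U i"] \<T> by (force simp: C_def)
    qed
    ultimately have "hausdorff_content parabolic_dist s' \<delta> (heavy_points M m s)
        \<le> (\<Sum>i. ennreal (diam_pow parabolic_dist s' (U i)))"
      unfolding hausdorff_content_def by (intro INF_lower) (auto simp: U(1)[symmetric])
    also have "\<dots> \<le> (\<Sum>i. f (U i))"
    proof (intro suminf_le summableI)
      fix i
      show "ennreal (diam_pow parabolic_dist s' (U i)) \<le> f (U i)"
        using diam_pow_pcube_le[OF m _ s(2), of "U i"] U(2)[of i] \<T>
        by (auto simp: f_def C_def diam_pow_def[of _ _ "{}"] intro!: ennreal_leI)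
    qed
    also have "\<dots> \<le> ennreal \<eta>" using U(3) total by (rule order_trans)
    finally show ?thesis by simp
  qed
  have "hausdorff_content parabolic_dist s' \<delta> (heavy_points M m s) \<le> 0" if "0 < \<delta>" for \<delta>
    by (rule ennreal_le_epsilon) (rule content[OF that])
  then show ?thesis by (auto simp: hausdorff_measure_def)
qed

section \<open>The dimension bound\<close>

text \<open>A point that is not heavy lies in no heavy cube of generation at least some \<open>k\<close>. For
  fixed \<open>k\<close>, the points of \<open>E\<close> with this property in a cube of generation \<open>k\<close> form a null
  set, because repeated refinement covers them by light cubes; and there are countably many
  such cubes.\<close>

lemma heavy_points_full_measure:
  fixes M :: "((real^'n) \<times> real) measure"
  assumes m: "m \<ge> 2" and M: "radon_measure M" and E: "E \<in> sets borel" "emeasure M (UNIV - E) = 0"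
    and s: "\<tau> < s / 2"
    and step: "\<And>Q. Q \<in> pcubes m \<Longrightarrow> 0 \<le> generation m Q \<Longrightarrow>
      \<exists>T\<subseteq>pcubes m. (\<forall>R\<in>T. generation m Q + 1 \<le> generation m R) \<and> E \<inter> Q \<subseteq> \<Union>T \<and>
        (\<integral>\<^sup>+R. cube_weight M m \<tau> R \<partial>count_space T) \<le> cube_weight M m \<tau> Q"
  shows "emeasure M (UNIV - heavy_points M m s) = 0"
proof -
  have sM: "sets M = sets borel" using M by (simp add: radon_measure_def)
  define H where "H k = \<Union>{Q \<in> pcubes m. int k \<le> generation m Q \<and> side m Q powr s < measure M Q}"
    for k :: nat
  have H: "H k \<in> sets M" for k
    unfolding H_def
    by (intro sets.countable_Union countable_subset_pcubes[of _ m]) (auto intro: pcube_sets[OF M])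
  have ES: "E \<in> sets M" using E sM by simp
  have null: "E \<inter> Q - H k \<in> null_sets M" if Q: "Q \<in> pcubes m" "generation m Q = int k" for Q k
  proof (rule null_setsI)
    show "E \<inter> Q - H k \<in> sets M" using H ES pcube_sets[OF M Q(1)] by blast
    show "emeasure M (E \<inter> Q - H k) = 0"
    proof (rule null_if_cubes_light[OF m M s, of "int k" "cube_weight M m \<tau> Q"])
      show "\<exists>T\<subseteq>pcubes m. (\<forall>R\<in>T. int k + int l \<le> generation m R) \<and> E \<inter> Q - H k \<subseteq> \<Union>T \<and>
        (\<integral>\<^sup>+R. cube_weight M m \<tau> R \<partial>count_space T) \<le> cube_weight M m \<tau> Q" for l
        using refine_repeatedly[OF step, of Q l] Q by fastforce
      show "measure M R \<le> side m R powr s"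
        if "R \<in> pcubes m" "int k \<le> generation m R" "R \<inter> (E \<inter> Q - H k) \<noteq> {}" for R
        using that by (force simp: H_def)
    qed (auto simp: cube_weight_def)
  qed
  have "UNIV - heavy_points M m s \<subseteq> (UNIV - E) \<union>
      (\<Union>k. \<Union>Q\<in>{Q \<in> pcubes m. generation m Q = int k}. E \<inter> Q - H k)"
  proof
    fix x assume "x \<in> UNIV - heavy_points M m s"
    then obtain k where k: "x \<notin> H k" by (auto simp: heavy_points_def H_def)
    obtain Q where "Q \<in> pcubes m" "generation m Q = int k" "x \<in> Q"
      using pcube_containing[OF m] .
    with k show "x \<in> (UNIV - E) \<union>
      (\<Union>k. \<Union>Q\<in>{Q \<in> pcubes m. generation m Q = int k}. E \<inter> Q - H k)" by blast
  qed
  moreover have "(UNIV - E) \<union>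
      (\<Union>k. \<Union>Q\<in>{Q \<in> pcubes m. generation m Q = int k}. E \<inter> Q - H k) \<in> null_sets M"
  proof (intro null_sets.Un null_sets_UN null_sets_UN')
    show "UNIV - E \<in> null_sets M" using E sM by (intro null_setsI) auto
    show "countable {Q \<in> pcubes m :: ((real^'n) \<times> real) set set. generation m Q = int k}" for k
      by (rule countable_subset_pcubes[of _ m]) auto
  qed (use null in auto)
  ultimately have "UNIV - heavy_points M m s \<in> null_sets M"
    using heavy_points_borel[of M m s] sM by (elim null_sets_subset[rotated 2]) auto
  then show ?thesis by blast
qed

text \<open>The dimension is bounded by twice the exponent \<open>\<tau>\<close> because the weight contains the
  square root of the measure: light cubes enter with \<open>\<mu>(R)\<^sup>1\<^sup>/\<^sup>2 \<le> (side R)\<^sup>s\<^sup>/\<^sup>2\<close>.\<close>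

lemma upper_parabolic_dim_le:
  fixes M :: "((real^'n) \<times> real) measure"
  assumes m: "m \<ge> 2" and M: "radon_measure M" and E: "E \<in> sets borel" "emeasure M (UNIV - E) = 0"
    and \<tau>: "0 \<le> \<tau>"
    and step: "\<And>Q. Q \<in> pcubes m \<Longrightarrow> 0 \<le> generation m Q \<Longrightarrow>
      \<exists>T\<subseteq>pcubes m. (\<forall>R\<in>T. generation m Q + 1 \<le> generation m R) \<and> E \<inter> Q \<subseteq> \<Union>T \<and>
        (\<integral>\<^sup>+R. cube_weight M m \<tau> R \<partial>count_space T) \<le> cube_weight M m \<tau> Q"
  shows "upper_parabolic_dim M \<le> ereal (2 * \<tau>)"
proof (rule ereal_le_epsilon2)
  fix e :: real assume e: "0 < e"
  define s where "s = 2 * \<tau> + e / 2"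
  let ?G = "heavy_points M m s"
  have full: "emeasure M (UNIV - ?G) = 0"
    using e by (intro heavy_points_full_measure[OF m M E _ step]) (auto simp: s_def)
  have "upper_parabolic_dim M \<le> hausdorff_dim parabolic_dist ?G"
    unfolding upper_parabolic_dim_def using full heavy_points_borel by (intro INF_lower) auto
  also have "\<dots> \<le> ereal (2 * \<tau> + e)"
    unfolding hausdorff_dim_def using e \<tau>
    by (intro INF_lower CollectI conjI hausdorff_measure_heavy_points[OF m M]) (auto simp: s_def)
  finally show "upper_parabolic_dim M \<le> ereal (2 * \<tau>) + ereal e" by simp
qed

theorem theorem2p10:
  fixes m :: nat
    and M :: "((real^'n) \<times> real) measure"
    and E :: "((real^'n) \<times> real) set"
    and rho lam :: real
  assumes "m \<ge> 2"
    and "radon_measure M"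
    and "E \<in> sets borel"
    and "emeasure M (UNIV - E) = 0"
    and "0 < rho" and "rho < real CARD('n) + 2"
    and "lam > 0"
    and "\<And>Q. Q \<in> pcubes m \<Longrightarrow> side m Q \<le> 1 \<Longrightarrow>
           net_content m (real CARD('n) + 2 - rho) (ennreal (side m Q / real m)) (E \<inter> Q)
             < ennreal (side m Q powr (real CARD('n) + 2 - rho))
           \<or> (\<Sum>R\<in>Child m Q. measure M R powr (1/2) * vol m R powr (1/2))
               \<le> real m powr (- lam) * measure M Q powr (1/2) * vol m Q powr (1/2)"
  shows "upper_parabolic_dim M \<le> ereal (real CARD('n) + 2 - lam * rho / (lam + rho))"
proof -
  note m = assms(1) and M = assms(2)
  \<comment> \<open>The largest exponent for which both refinement steps do not increase the weight:
      covers of small content require \<open>2\<beta> \<le> rho\<close>, children require \<open>\<beta> \<le> lam\<close>.\<close>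
  define \<beta> where "\<beta> = min lam (rho / 2)"
  define \<tau> where "\<tau> = (real CARD('n) + 2) / 2 - \<beta>"
  have \<tau>: "0 \<le> \<tau>" "(real CARD('n) + 2 - rho) / 2 \<le> \<tau>"
    using assms(6) by (auto simp: \<tau>_def \<beta>_def field_simps min_def)
  have "\<exists>T\<subseteq>pcubes m. (\<forall>R\<in>T. generation m Q + 1 \<le> generation m R) \<and> E \<inter> Q \<subseteq> \<Union>T \<and>
      (\<integral>\<^sup>+R. cube_weight M m \<tau> R \<partial>count_space T) \<le> cube_weight M m \<tau> Q"
    if Q: "Q \<in> pcubes m" "0 \<le> generation m Q" for Q
  proof -
    have "side m Q \<le> 1" using side_le_power[OF m, of 0 Q] Q by simp
    from assms(8)[OF Q(1) this] show ?thesis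
    proof
      assume "net_content m (real CARD('n) + 2 - rho) (ennreal (side m Q / real m)) (E \<inter> Q)
        < ennreal (side m Q powr (real CARD('n) + 2 - rho))"
      then show ?thesis by (rule refine_by_small_content[OF m M Q(1) \<tau>(2)])
    next
      assume "(\<Sum>R\<in>Child m Q. measure M R powr (1/2) * vol m R powr (1/2))
        \<le> real m powr (- lam) * measure M Q powr (1/2) * vol m Q powr (1/2)"
      moreover have "\<beta> \<le> lam" by (simp add: \<beta>_def)
      ultimately show ?thesis
        using refine_by_children[OF m Q(1), of \<beta> lam M] unfolding \<tau>_def by blast
    qed
  qed
  then have "upper_parabolic_dim M \<le> ereal (2 * \<tau>)"
    by (rule upper_parabolic_dim_le[OF m M assms(3,4) \<tau>(1)])
  also have "2 * \<tau> \<le> real CARD('n) + 2 - lam * rho / (lam + rho)"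
  proof -
    have "lam * rho / (lam + rho) \<le> lam" "lam * rho / (lam + rho) \<le> rho"
      using assms(5,7) by (simp_all add: field_simps)
    then have "lam * rho / (lam + rho) \<le> 2 * \<beta>" using assms(7) by (auto simp: \<beta>_def min_def)
    moreover have "2 * \<tau> = real CARD('n) + 2 - 2 * \<beta>" by (simp add: \<tau>_def field_simps)
    ultimately show ?thesis by linarith
  qed
  finally show ?thesis by simp
qed

end
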